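(* The Banach algebra $C(X)'_1$ is hermitian (every self-adjoint element has real spectrum) and semisimple.
   Context: Let $X$ be a non-empty compact Hausdorff space and $\sigma:X\to X$ a homeomorphism. $C(X)$ is the algebra of continuous complex functions on $X$ with sup norm $\|\cdot\|_\infty$, and $\alpha(f)=f\circ\sigma^{-1}$. $\ell^1(\Sigma)$ is the set of maps $\ell:\mathbb{Z}\to C(X)$ with $\|\ell\|=\sum_k\|\ell(k)\|_\infty<\infty$, with product $(\ell\ell')(n)=\sum_k\ell(k)\,\alpha^k(\ell'(n-k))$ and involution $\ell^*(n)=\overline{\alpha^n(\ell(-n))}$; it is a unital Banach $*$-algebra, in which $C(X)$ is embedded as the functions supported at $0\in\mathbb{Z}$. $C(X)'_1$ denotes the commutant of $C(X)$ in $\ell^1(\Sigma)$ (a commutative closed unital $*$-subalgebra), with the norm and involution of $\ell^1(\Sigma)$. *)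

theory Defs
  imports "HOL-Analysis.Analysis"
begin

text \<open>Elements of l^1(Sigma) are represented as maps  int => (X => complex),
  i.e. l n is the n-th coefficient, a function on X.\<close>

definition cx :: "('a::topological_space \<Rightarrow> complex) set" where
  "cx = {f. continuous_on UNIV f}"

definition supnorm :: "('a \<Rightarrow> complex) \<Rightarrow> real" where
  "supnorm f = (SUP x. cmod (f x))"

definition spow :: "('a \<Rightarrow> 'a) \<Rightarrow> int \<Rightarrow> 'a \<Rightarrow> 'a" where
  "spow \<sigma> k = (if k \<ge> 0 then \<sigma> ^^ nat k else inv \<sigma> ^^ nat (- k))"

definition alpha :: "('a \<Rightarrow> 'a) \<Rightarrow> int \<Rightarrow> ('a \<Rightarrow> complex) \<Rightarrow> 'a \<Rightarrow> complex" where
  "alpha \<sigma> k f = f \<circ> spow \<sigma> (- k)"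

definition l1 :: "(int \<Rightarrow> 'a::topological_space \<Rightarrow> complex) set" where
  "l1 = {l. (\<forall>k. l k \<in> cx) \<and> (\<lambda>k. supnorm (l k)) summable_on UNIV}"

text \<open>Product (l l')(n) = sum_k l(k) alpha^k(l'(n-k)); the series converges in sup norm,
  so its value at x is the (absolutely convergent) pointwise sum.\<close>
definition l1_mult :: "('a \<Rightarrow> 'a) \<Rightarrow> (int \<Rightarrow> 'a \<Rightarrow> complex) \<Rightarrow> (int \<Rightarrow> 'a \<Rightarrow> complex) \<Rightarrow> (int \<Rightarrow> 'a \<Rightarrow> complex)" where
  "l1_mult \<sigma> l l' = (\<lambda>n x. \<Sum>\<^sub>\<infinity>k. l k x * alpha \<sigma> k (l' (n - k)) x)"

definition l1_star :: "('a \<Rightarrow> 'a) \<Rightarrow> (int \<Rightarrow> 'a \<Rightarrow> complex) \<Rightarrow> (int \<Rightarrow> 'a \<Rightarrow> complex)" where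
  "l1_star \<sigma> l = (\<lambda>n x. cnj (alpha \<sigma> n (l (- n)) x))"

definition l1_one :: "int \<Rightarrow> 'a \<Rightarrow> complex" where
  "l1_one = (\<lambda>n x. if n = 0 then 1 else 0)"

definition l1_zero :: "int \<Rightarrow> 'a \<Rightarrow> complex" where
  "l1_zero = (\<lambda>n x. 0)"

definition l1_add :: "(int \<Rightarrow> 'a \<Rightarrow> complex) \<Rightarrow> (int \<Rightarrow> 'a \<Rightarrow> complex) \<Rightarrow> (int \<Rightarrow> 'a \<Rightarrow> complex)" where
  "l1_add l l' = (\<lambda>n x. l n x + l' n x)"

definition l1_scale :: "complex \<Rightarrow> (int \<Rightarrow> 'a \<Rightarrow> complex) \<Rightarrow> (int \<Rightarrow> 'a \<Rightarrow> complex)" where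
  "l1_scale c l = (\<lambda>n x. c * l n x)"

definition embed :: "('a \<Rightarrow> complex) \<Rightarrow> (int \<Rightarrow> 'a \<Rightarrow> complex)" where
  "embed f = (\<lambda>n. if n = 0 then f else (\<lambda>x. 0))"

definition commutant :: "('a::topological_space \<Rightarrow> 'a) \<Rightarrow> (int \<Rightarrow> 'a \<Rightarrow> complex) set" where
  "commutant \<sigma> = {l \<in> l1. \<forall>f \<in> cx. l1_mult \<sigma> (embed f) l = l1_mult \<sigma> l (embed f)}"

definition alg_spectrum :: "('a \<Rightarrow> 'a) \<Rightarrow> (int \<Rightarrow> 'a \<Rightarrow> complex) set \<Rightarrow> (int \<Rightarrow> 'a \<Rightarrow> complex) \<Rightarrow> complex set" where
  "alg_spectrum \<sigma> A a = {z. \<not> (\<exists>b \<in> A.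
      l1_mult \<sigma> (l1_add a (l1_scale (- z) l1_one)) b = l1_one \<and>
      l1_mult \<sigma> b (l1_add a (l1_scale (- z) l1_one)) = l1_one)}"

definition hermitian :: "('a \<Rightarrow> 'a) \<Rightarrow> (int \<Rightarrow> 'a \<Rightarrow> complex) set \<Rightarrow> bool" where
  "hermitian \<sigma> A \<longleftrightarrow> (\<forall>a \<in> A. l1_star \<sigma> a = a \<longrightarrow> alg_spectrum \<sigma> A a \<subseteq> \<real>)"

definition left_ideal :: "('a \<Rightarrow> 'a) \<Rightarrow> (int \<Rightarrow> 'a \<Rightarrow> complex) set \<Rightarrow> (int \<Rightarrow> 'a \<Rightarrow> complex) set \<Rightarrow> bool" where
  "left_ideal \<sigma> A L \<longleftrightarrow> L \<subseteq> A \<and> L \<noteq> A \<and> l1_zero \<in> L \<and>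
     (\<forall>x \<in> L. \<forall>y \<in> L. l1_add x y \<in> L) \<and>
     (\<forall>c. \<forall>x \<in> L. l1_scale c x \<in> L) \<and>
     (\<forall>b \<in> A. \<forall>x \<in> L. l1_mult \<sigma> b x \<in> L)"

definition maximal_left_ideal :: "('a \<Rightarrow> 'a) \<Rightarrow> (int \<Rightarrow> 'a \<Rightarrow> complex) set \<Rightarrow> (int \<Rightarrow> 'a \<Rightarrow> complex) set \<Rightarrow> bool" where
  "maximal_left_ideal \<sigma> A L \<longleftrightarrow> left_ideal \<sigma> A L \<and> (\<forall>M. left_ideal \<sigma> A M \<and> L \<subseteq> M \<longrightarrow> M = L)"

definition jacobson_radical :: "('a \<Rightarrow> 'a) \<Rightarrow> (int \<Rightarrow> 'a \<Rightarrow> complex) set \<Rightarrow> (int \<Rightarrow> 'a \<Rightarrow> complex) set" where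
  "jacobson_radical \<sigma> A = A \<inter> \<Inter> {L. maximal_left_ideal \<sigma> A L}"

definition semisimple :: "('a \<Rightarrow> 'a) \<Rightarrow> (int \<Rightarrow> 'a \<Rightarrow> complex) set \<Rightarrow> bool" where
  "semisimple \<sigma> A \<longleftrightarrow> jacobson_radical \<sigma> A = {l1_zero}"

end

theory Submission
  imports Defs
begin

text \<open>
  By Urysohn, \<open>l\<close> commutes with \<open>C(X)\<close> iff \<open>l k\<close> vanishes at every \<open>x\<close> with \<open>\<sigma>\<^sup>-\<^sup>k x \<noteq> x\<close>. On such
  elements the twisted product and the involution become those of \<open>\<ell>\<^sup>1(\<int>)\<close> at each point \<open>x\<close>, so
  \<open>l \<mapsto> \<Sum>\<^sub>k l k x * t\<^sup>k\<close> with \<open>\<bar>t\<bar> = 1\<close> is a *-character of the commutant. These characters separate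
  points, and their kernels are maximal ideals: this is semisimplicity.

  The spectral radius of \<open>g\<close> is at most \<open>r = sup \<bar>\<chi>(g)\<bar>\<close> over these characters \<open>\<chi>\<close>, since for \<open>g\<close>
  supported in \<open>[-K, K]\<close> the power \<open>g\<^sup>n\<close> has at most \<open>2nK + 1\<close> nonzero coefficients, each of size at
  most \<open>r\<^sup>n\<close>. If \<open>a\<close> is self-adjoint and \<open>z\<close> is not real, then \<open>h = (a - z) (a - cnj z)\<close> satisfies
  \<open>0 < (Im z)\<^sup>2 \<le> \<chi>(h) \<le> M\<close>, so the Neumann series inverts \<open>h / M = 1 - (1 - h / M)\<close>, whence \<open>a - z\<close>
  is invertible in the commutant.
\<close>

section \<open>Fourier coefficients of absolutely convergent series on the unit circle\<close>

lemma integral_exp_int_multiple: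
  fixes n :: int
  shows "((\<lambda>\<theta>. exp (\<i> * of_int n * of_real \<theta>)) has_integral (if n = 0 then of_real (2 * pi) else 0)) {0..2 * pi}"
proof (cases "n = 0")
  case True
  then show ?thesis
    using has_integral_const_real[of "1::complex" 0 "2 * pi"] by (simp add: scaleR_conv_of_real)
next
  case False
  let ?F = "\<lambda>\<theta>::real. exp (\<i> * of_int n * of_real \<theta>) / (\<i> * of_int n)"
  have "((\<lambda>\<theta>. exp (\<i> * of_int n * of_real \<theta>)) has_integral (?F (2 * pi) - ?F 0)) {0..2 * pi}"
  proof (rule fundamental_theorem_of_calculus)
    fix \<theta> :: real
    have "((\<lambda>z. exp (\<i> * of_int n * z) / (\<i> * of_int n)) has_field_derivative exp (\<i> * of_int n * of_real \<theta>))
        (at (of_real \<theta>))"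
      using False by (auto intro!: derivative_eq_intros)
    then show "(?F has_vector_derivative exp (\<i> * of_int n * of_real \<theta>)) (at \<theta> within {0..2 * pi})"
      by (intro has_vector_derivative_real_field)
  qed simp
  moreover have "exp (\<i> * of_int n * of_real (2 * pi)) = (1::complex)"
    using exp_integer_2pi[of "of_int n"] by (simp add: mult_ac)
  ultimately show ?thesis
    using False by simp
qed

text \<open>Multiplying the polynomial by \<open>exp (- i k \<theta>)\<close> leaves its modulus
  unchanged, and integrating over a full period isolates \<open>2 pi * c k\<close> by orthogonality.
  Dividing the resulting estimate by the length of the interval gives the bound.\<close>

lemma finite_fourier_coeff_le_sup:
  fixes c :: "int \<Rightarrow> complex"
  assumes F: "finite F" "k \<in> F"
    and le: "\<And>t. cmod t = 1 \<Longrightarrow> cmod (\<Sum>n\<in>F. c n * t powi n) \<le> R"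
  shows "cmod (c k) \<le> R"
proof -
  let ?f = "\<lambda>\<theta>::real. \<Sum>n\<in>F. c n * exp (\<i> * of_int (n - k) * of_real \<theta>)"
  have "(?f has_integral (\<Sum>n\<in>F. c n * (if n - k = 0 then of_real (2 * pi) else 0))) {0..2 * pi}"
    by (intro has_integral_sum F has_integral_mult_right integral_exp_int_multiple)
  moreover have "(\<Sum>n\<in>F. c n * (if n - k = 0 then of_real (2 * pi) else 0)) = c k * of_real (2 * pi)"
    using F by (simp add: if_distrib cong: if_cong)
  ultimately have int: "(?f has_integral (c k * of_real (2 * pi))) (cbox 0 (2 * pi))"
    by (simp only: cbox_interval)
  have bound: "cmod (?f \<theta>) \<le> R" for \<theta> :: real
  proof -
    have "exp (\<i> * of_int (n - k) * of_real \<theta>) = exp (- \<i> * of_int k * of_real \<theta>) * cis \<theta> powi n" for n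
      by (simp add: cis_conv_exp exp_power_int exp_add[symmetric] algebra_simps)
    then have "?f \<theta> = exp (- \<i> * of_int k * of_real \<theta>) * (\<Sum>n\<in>F. c n * cis \<theta> powi n)"
      by (simp add: sum_distrib_left mult_ac)
    moreover have "cmod (exp (- \<i> * of_int k * of_real \<theta>)) = 1"
      by simp
    ultimately show ?thesis
      using le[of "cis \<theta>"] by (simp add: norm_mult)
  qed
  have "0 \<le> R"
    using bound[of 0] norm_ge_zero order_trans by blast
  from has_integral_bound[OF this int bound] show ?thesis
    by (simp add: norm_mult)
qed

text \<open>The conclusion covers all supersets of \<open>F\<close>, so that \<open>F\<close> can be
  enlarged later, either to contain a prescribed index or to become a symmetric interval.\<close>

lemma summable_tail_le:
  fixes f :: "'b \<Rightarrow> real"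
  assumes f: "f summable_on UNIV" "\<And>k. 0 \<le> f k" and "0 < e"
  obtains F where "finite F" "\<And>F'. F \<subseteq> F' \<Longrightarrow> infsum f (- F') \<le> e"
proof -
  from \<open>0 < e\<close> obtain F where F: "finite F" "dist (sum f F) (infsum f UNIV) \<le> e"
    using infsum_finite_approximation[OF f(1)] by blast
  have s: "f summable_on A" for A
    by (rule summable_on_subset_banach[OF f(1)]) simp
  have "infsum f (- F') \<le> e" if "F \<subseteq> F'" for F'
  proof -
    have "infsum f UNIV = infsum f F + infsum f (- F)"
      using infsum_Un_disjoint[OF s s, of F "- F"] by simp
    moreover have "infsum f (- F') \<le> infsum f (- F)"
      by (intro infsum_mono2 s) (use that f in auto)
    ultimately show ?thesis
      using F by (simp add: dist_real_def)
  qed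
  then show thesis
    using F(1) that by blast
qed

text \<open>Dropping a tail of absolute sum at most \<open>e\<close> changes the series by at most
  \<open>e\<close> at every point of the circle, so the finite case applies with
  \<open>R + e\<close>.\<close>

lemma fourier_coeff_le_sup:
  fixes c :: "int \<Rightarrow> complex"
  assumes c: "(\<lambda>n. norm (c n)) summable_on UNIV"
    and le: "\<And>t. cmod t = 1 \<Longrightarrow> cmod (\<Sum>\<^sub>\<infinity>n. c n * t powi n) \<le> R"
  shows "cmod (c k) \<le> R"
proof (rule field_le_epsilon)
  fix e :: real assume "0 < e"
  then obtain F where F: "finite F" "\<And>F'. F \<subseteq> F' \<Longrightarrow> (\<Sum>\<^sub>\<infinity>n\<in>-F'. cmod (c n)) \<le> e"
    using summable_tail_le[OF c norm_ge_zero] by metis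
  \<comment> \<open>The finite case bounds only coefficients whose index is kept, so
    \<open>k\<close> is put into the truncation set.\<close>
  let ?F = "insert k F"
  have tail: "(\<Sum>\<^sub>\<infinity>n\<in>-?F. cmod (c n)) \<le> e"
    by (rule F(2)) auto
  show "cmod (c k) \<le> R + e"
  proof (rule finite_fourier_coeff_le_sup)
    fix t :: complex assume t: "cmod t = 1"
    have eq: "cmod (c n * t powi n) = cmod (c n)" for n
      using t by (simp add: norm_mult norm_power_int)
    have "(\<lambda>n. norm (c n * t powi n)) summable_on UNIV"
      using c by (simp add: eq)
    then have s: "(\<lambda>n. norm (c n * t powi n)) summable_on A" for A
      by (rule summable_on_subset_banach) simp
    have "(\<Sum>\<^sub>\<infinity>n. c n * t powi n) = (\<Sum>n\<in>?F. c n * t powi n) + (\<Sum>\<^sub>\<infinity>n\<in>-?F. c n * t powi n)"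
      using infsum_Un_disjoint[of "\<lambda>n. c n * t powi n" ?F "-?F"] s[THEN abs_summable_summable] F
      by (simp del: sum.insert_if sum.insert insert_iff add: Un_insert_left[symmetric] infsum_finite)
    moreover have "cmod (\<Sum>\<^sub>\<infinity>n\<in>-?F. c n * t powi n) \<le> e"
      using norm_infsum_bound[OF s[of "-?F"]] tail by (simp add: eq)
    ultimately show "cmod (\<Sum>n\<in>?F. c n * t powi n) \<le> R + e"
      using le[OF t] norm_triangle_ineq4[of "\<Sum>\<^sub>\<infinity>n. c n * t powi n" "\<Sum>\<^sub>\<infinity>n\<in>-?F. c n * t powi n"] by simp
  qed (use F in auto)
qed

section \<open>Norm, untwisted convolution and characters\<close>

definition l1_norm :: "(int \<Rightarrow> 'a \<Rightarrow> complex) \<Rightarrow> real" where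
  "l1_norm l = (\<Sum>\<^sub>\<infinity>k. supnorm (l k))"

text \<open>The product with the twist by \<open>alpha\<close> removed. By
  \<open>l1_mult_eq_conv\<close> it agrees with \<open>l1_mult\<close> when the left factor is
  supported in the periods, so powers and norm bounds can be treated without mentioning
  \<open>\<sigma>\<close>.\<close>

definition l1_conv :: "(int \<Rightarrow> 'a \<Rightarrow> complex) \<Rightarrow> (int \<Rightarrow> 'a \<Rightarrow> complex) \<Rightarrow> (int \<Rightarrow> 'a \<Rightarrow> complex)" where
  "l1_conv l l' = (\<lambda>n x. \<Sum>\<^sub>\<infinity>k. l k x * l' (n - k) x)"

text \<open>The character attached to the point \<open>x\<close> and the number \<open>t\<close> of
  modulus 1. On \<open>l1\<close> it is multiplicative for \<open>l1_conv\<close>.\<close>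

definition gelfand :: "(int \<Rightarrow> 'a \<Rightarrow> complex) \<Rightarrow> 'a \<Rightarrow> complex \<Rightarrow> complex" where
  "gelfand l x t = (\<Sum>\<^sub>\<infinity>k. l k x * t powi k)"

primrec l1_power :: "(int \<Rightarrow> 'a \<Rightarrow> complex) \<Rightarrow> nat \<Rightarrow> (int \<Rightarrow> 'a \<Rightarrow> complex)" where
  "l1_power l 0 = l1_one"
| "l1_power l (Suc n) = l1_conv l (l1_power l n)"

text \<open>The set of admissible indices varies with the point. Taking
  \<open>S = periods \<sigma>\<close> gives the commutant.\<close>

definition l1_supported :: "('b::topological_space \<Rightarrow> int set) \<Rightarrow> (int \<Rightarrow> 'b \<Rightarrow> complex) set" where
  "l1_supported S = {l \<in> l1. \<forall>k x. k \<notin> S x \<longrightarrow> l k x = 0}"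

lemma supnorm_le: "(\<And>x. cmod (f x) \<le> B) \<Longrightarrow> supnorm f \<le> B"
  unfolding supnorm_def by (rule cSUP_least) auto

lemma one_in_l1: "l1_one \<in> l1"
proof -
  have "(\<lambda>k. supnorm (l1_one k :: 'a \<Rightarrow> complex)) summable_on UNIV"
    by (rule finite_nonzero_values_imp_summable_on)
      (auto intro: finite_subset[of _ "{0}"] simp: l1_one_def supnorm_def)
  then show ?thesis
    by (auto simp: l1_def l1_one_def cx_def)
qed

lemma gelfand_one: "gelfand l1_one x t = 1"
proof -
  have "gelfand l1_one x t = (\<Sum>\<^sub>\<infinity>k\<in>{0}. l1_one k x * t powi k)"
    unfolding gelfand_def by (rule infsum_cong_neutral) (auto simp: l1_one_def)
  then show ?thesis
    by (simp add: l1_one_def)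
qed

lemma l1_conv_eq_0:
  assumes "\<And>k. l k x = 0 \<or> l' (n - k) x = 0"
  shows "l1_conv l l' n x = 0"
proof -
  have "(\<lambda>k. l k x * l' (n - k) x) = (\<lambda>k. 0)"
    using assms by auto
  then show ?thesis
    by (simp add: l1_conv_def)
qed

lemma l1_power_finite_support:
  assumes "\<forall>k x. \<bar>k\<bar> > int K \<longrightarrow> p k x = 0"
  shows "\<bar>k\<bar> > int (m * K) \<Longrightarrow> l1_power p m k x = 0"
proof (induction m arbitrary: k)
  case 0
  then show ?case
    by (simp add: l1_one_def)
next
  case (Suc m)
  \<comment> \<open>Supports add under convolution: an index beyond \<open>(m + 1) * K\<close>
    cannot split into one within \<open>K\<close> and one within \<open>m * K\<close>.\<close>
  have "p j x = 0 \<or> l1_power p m (k - j) x = 0" for j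
  proof (cases "\<bar>j\<bar> > int K")
    case False
    then have "\<bar>k - j\<bar> > int (m * K)"
      using Suc.prems by (auto simp: algebra_simps)
    then show ?thesis
      using Suc.IH by blast
  qed (use assms in blast)
  then show ?case
    by (simp add: l1_conv_eq_0)
qed

lemma gelfand_scale: "gelfand (l1_scale c l) x t = c * gelfand l x t"
  unfolding gelfand_def l1_scale_def mult.assoc by (rule infsum_cmult_right')

lemma gelfand_zero: "gelfand l1_zero x t = 0"
  by (simp add: gelfand_def l1_zero_def)

section \<open>Estimates, infinite sums and products in l1 over a compact space\<close>

context
  assumes compact_space: "compact (UNIV :: 'a::topological_space set)"
begin

lemma cmod_le_supnorm:
  fixes f :: "'a \<Rightarrow> complex"
  assumes "f \<in> cx"
  shows "cmod (f x) \<le> supnorm f"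
proof -
  have "compact (range (\<lambda>x. cmod (f x)))"
    using assms by (intro compact_continuous_image compact_space continuous_on_norm) (simp add: cx_def)
  then have "bdd_above (range (\<lambda>x. cmod (f x)))"
    by (intro bounded_imp_bdd_above compact_imp_bounded)
  then show ?thesis
    unfolding supnorm_def by (rule cSUP_upper[OF UNIV_I])
qed

lemma supnorm_nonneg:
  fixes f :: "'a \<Rightarrow> complex"
  assumes "f \<in> cx"
  shows "0 \<le> supnorm f"
  using cmod_le_supnorm[OF assms] norm_ge_zero order_trans by blast

lemma l1_coeff_le:
  fixes l :: "int \<Rightarrow> 'a \<Rightarrow> complex"
  assumes "l \<in> l1"
  shows "cmod (l k x) \<le> supnorm (l k)"
  using assms by (auto simp: l1_def intro: cmod_le_supnorm)

lemma l1_supnorm_nonneg: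
  fixes l :: "int \<Rightarrow> 'a \<Rightarrow> complex"
  assumes "l \<in> l1"
  shows "0 \<le> supnorm (l k)"
  using assms by (auto simp: l1_def intro: supnorm_nonneg)

lemma l1_norm_nonneg:
  fixes l :: "int \<Rightarrow> 'a \<Rightarrow> complex"
  assumes "l \<in> l1"
  shows "0 \<le> l1_norm l"
  unfolding l1_norm_def by (intro infsum_nonneg l1_supnorm_nonneg assms)

lemma l1_pointwise_summable:
  fixes l :: "int \<Rightarrow> 'a \<Rightarrow> complex"
  assumes "l \<in> l1"
  shows "(\<lambda>k. norm (l k x)) summable_on UNIV"
  using assms Infinite_Sum.abs_summable_on_comparison_test'[of "\<lambda>k. supnorm (l k)" UNIV "\<lambda>k. l k x"]
  by (auto simp: l1_def intro: cmod_le_supnorm)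

lemma gelfand_summable:
  fixes l :: "int \<Rightarrow> 'a \<Rightarrow> complex"
  assumes "l \<in> l1" "cmod t = 1"
  shows "(\<lambda>k. norm (l k x * t powi k)) summable_on UNIV"
  using l1_pointwise_summable[OF assms(1), of x] assms(2)
  by (simp add: norm_mult norm_power_int)

lemma gelfand_le_l1_norm:
  fixes l :: "int \<Rightarrow> 'a \<Rightarrow> complex"
  assumes "l \<in> l1" "cmod t = 1"
  shows "cmod (gelfand l x t) \<le> l1_norm l"
proof -
  have "cmod (gelfand l x t) \<le> (\<Sum>\<^sub>\<infinity>k. norm (l k x * t powi k))"
    unfolding gelfand_def by (rule norm_infsum_bound[OF gelfand_summable[OF assms]])
  also have "\<dots> \<le> l1_norm l"
    unfolding l1_norm_def using gelfand_summable[OF assms] l1_coeff_le[OF assms(1)] assms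
    by (intro infsum_mono) (auto simp: l1_def norm_mult norm_power_int)
  finally show ?thesis .
qed

text \<open>For fixed \<open>x\<close>, the function \<open>gelfand l x\<close> on the circle is the
  Fourier series with coefficients \<open>l k x\<close>.\<close>

lemma l1_coeff_le_gelfand:
  fixes l :: "int \<Rightarrow> 'a \<Rightarrow> complex"
  assumes "l \<in> l1" "\<And>t. cmod t = 1 \<Longrightarrow> cmod (gelfand l x t) \<le> R"
  shows "cmod (l k x) \<le> R"
  by (rule fourier_coeff_le_sup[OF l1_pointwise_summable[OF assms(1)]])
    (use assms(2) in \<open>simp add: gelfand_def\<close>)

text \<open>The constructions below come with pointwise majorants of their coefficients; this turns
  such a majorant into membership and a norm bound at once.\<close>

lemma l1_comparison:
  fixes l :: "int \<Rightarrow> 'a \<Rightarrow> complex"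
  assumes "\<And>k. l k \<in> cx" "\<And>k x. cmod (l k x) \<le> B k" "B summable_on UNIV"
  shows "l \<in> l1" "l1_norm l \<le> infsum B UNIV"
proof -
  have le: "supnorm (l k) \<le> B k" for k
    by (rule supnorm_le) (rule assms)
  have sum: "(\<lambda>k. supnorm (l k)) summable_on UNIV"
    by (rule summable_on_comparison_test[OF assms(3)]) (auto intro: le supnorm_nonneg assms)
  then show "l \<in> l1"
    using assms by (simp add: l1_def)
  show "l1_norm l \<le> infsum B UNIV"
    unfolding l1_norm_def by (rule infsum_mono[OF sum assms(3) le])
qed

lemma l1_add_closed:
  fixes l :: "int \<Rightarrow> 'a \<Rightarrow> complex"
  assumes "l \<in> l1" "l' \<in> l1"
  shows "l1_add l l' \<in> l1" "l1_norm (l1_add l l') \<le> l1_norm l + l1_norm l'"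
proof -
  note rules = l1_comparison[of "l1_add l l'" "\<lambda>k. supnorm (l k) + supnorm (l' k)"]
  have c: "l1_add l l' k \<in> cx" for k
    using assms continuous_on_add[of UNIV "l k" "l' k"] by (simp add: l1_def cx_def l1_add_def)
  have b: "cmod (l1_add l l' k x) \<le> supnorm (l k) + supnorm (l' k)" for k x
    unfolding l1_add_def by (intro norm_triangle_le add_mono l1_coeff_le assms)
  have s: "(\<lambda>k. supnorm (l k) + supnorm (l' k)) summable_on UNIV"
    using assms by (intro summable_on_add) (auto simp: l1_def)
  show "l1_add l l' \<in> l1"
    by (rule rules(1)[OF c b s])
  show "l1_norm (l1_add l l') \<le> l1_norm l + l1_norm l'"
    using rules(2)[OF c b s] infsum_add[of "\<lambda>k. supnorm (l k)" UNIV "\<lambda>k. supnorm (l' k)"] assms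
    unfolding l1_def l1_norm_def by simp
qed

lemma gelfand_add:
  fixes l :: "int \<Rightarrow> 'a \<Rightarrow> complex"
  assumes "l \<in> l1" "l' \<in> l1" "cmod t = 1"
  shows "gelfand (l1_add l l') x t = gelfand l x t + gelfand l' x t"
  unfolding gelfand_def l1_add_def distrib_right
  by (rule infsum_add) (rule abs_summable_summable[OF gelfand_summable], fact, fact)+

lemma l1_scale_closed:
  fixes l :: "int \<Rightarrow> 'a \<Rightarrow> complex"
  assumes "l \<in> l1"
  shows "l1_scale c l \<in> l1"
proof (rule l1_comparison)
  show "l1_scale c l k \<in> cx" for k
    using assms continuous_on_mult_left[of UNIV "l k" c] by (simp add: l1_def cx_def l1_scale_def)
  show "cmod (l1_scale c l k x) \<le> cmod c * supnorm (l k)" for k x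
    unfolding l1_scale_def norm_mult by (intro mult_left_mono l1_coeff_le assms) simp
  show "(\<lambda>k. cmod c * supnorm (l k)) summable_on UNIV"
    using assms by (intro summable_on_cmult_right) (simp add: l1_def)
qed

text \<open>The difference has all its characters equal to 0, so its coefficients are bounded by 0.
  Algebraic identities for \<open>l1_conv\<close> are proved below by this reduction to arithmetic
  of complex numbers.\<close>

lemma l1_eqI_gelfand:
  fixes l :: "int \<Rightarrow> 'a \<Rightarrow> complex"
  assumes "l \<in> l1" "l' \<in> l1"
    and eq: "\<And>x t. cmod t = 1 \<Longrightarrow> gelfand l x t = gelfand l' x t"
  shows "l = l'"
proof (intro ext)
  fix k x
  let ?d = "l1_add l (l1_scale (-1) l')"
  have "cmod (?d k x) \<le> 0"
    by (rule l1_coeff_le_gelfand)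
      (use assms in \<open>auto simp: l1_add_closed l1_scale_closed gelfand_add gelfand_scale\<close>)
  then show "l k x = l' k x"
    by (simp add: l1_add_def l1_scale_def)
qed

text \<open>The numbers \<open>supnorm (L i k)\<close> are summable over all pairs
  \<open>(i, k)\<close>. Hence the sums over \<open>i\<close> and over \<open>k\<close> may be
  interchanged, both in the norm and in the characters.\<close>

lemma
  fixes L :: "'i \<Rightarrow> int \<Rightarrow> 'a \<Rightarrow> complex"
  assumes L: "\<And>i. L i \<in> l1" and sum: "(\<lambda>i. l1_norm (L i)) summable_on UNIV"
  shows infsum_in_l1: "(\<lambda>k x. \<Sum>\<^sub>\<infinity>i. L i k x) \<in> l1"
    and l1_norm_infsum_le: "l1_norm (\<lambda>k x. \<Sum>\<^sub>\<infinity>i. L i k x) \<le> (\<Sum>\<^sub>\<infinity>i. l1_norm (L i))"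
    and gelfand_infsum: "cmod t = 1 \<Longrightarrow>
      gelfand (\<lambda>k x. \<Sum>\<^sub>\<infinity>i. L i k x) x t = (\<Sum>\<^sub>\<infinity>i. gelfand (L i) x t)"
proof -
  have joint: "(\<lambda>(i, k). supnorm (L i k)) summable_on UNIV \<times> UNIV"
  proof (rule summable_on_SigmaI)
    show "((\<lambda>k. (\<lambda>(i, k). supnorm (L i k)) (i, k)) has_sum l1_norm (L i)) UNIV" for i
      using L[of i] by (simp add: l1_def l1_norm_def)
  qed (use sum l1_supnorm_nonneg[OF L] in auto)
  then have joint': "(\<lambda>(k, i). supnorm (L i k)) summable_on UNIV \<times> UNIV"
    using summable_on_swap[of "\<lambda>(k, i). supnorm (L i k)" UNIV UNIV] by simp
  have row: "(\<lambda>i. supnorm (L i k)) summable_on UNIV" for k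
    using summable_on_SigmaD1[OF joint', of k] by simp
  have B: "(\<lambda>k. \<Sum>\<^sub>\<infinity>i. supnorm (L i k)) summable_on UNIV"
    using summable_on_Sigma_banach[OF joint'] by simp
  have pw: "(\<lambda>i. norm (L i k x)) summable_on UNIV" for k x
    by (rule Infinite_Sum.abs_summable_on_comparison_test'[OF row[of k]]) (rule l1_coeff_le[OF L])
  have cont: "(\<lambda>x. \<Sum>\<^sub>\<infinity>i. L i k x) \<in> cx" for k
  proof -
    \<comment> \<open>By the Weierstrass test the finite partial sums converge uniformly, so each
      coefficient of the sum is again continuous.\<close>
    have ul: "uniform_limit UNIV (\<lambda>F x. \<Sum>i\<in>F. L i k x) (\<lambda>x. \<Sum>\<^sub>\<infinity>i. L i k x) (finite_subsets_at_top UNIV)"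
      by (rule Weierstrass_m_test_general[OF l1_coeff_le[OF L] row])
    have "continuous_on UNIV (\<lambda>x. \<Sum>i\<in>F. L i k x)" for F
      using L by (intro continuous_on_sum) (auto simp: l1_def cx_def)
    then show ?thesis
      unfolding cx_def
      using uniform_limit_theorem[OF always_eventually ul finite_subsets_at_top_neq_bot] by simp
  qed
  have le: "cmod (\<Sum>\<^sub>\<infinity>i. L i k x) \<le> (\<Sum>\<^sub>\<infinity>i. supnorm (L i k))" for k x
    using norm_infsum_bound[OF pw[of k x]] infsum_mono[OF pw[of k x] row[of k] l1_coeff_le[OF L]]
    by linarith
  show "(\<lambda>k x. \<Sum>\<^sub>\<infinity>i. L i k x) \<in> l1"
    by (rule l1_comparison(1)[OF cont le B])
  show "l1_norm (\<lambda>k x. \<Sum>\<^sub>\<infinity>i. L i k x) \<le> (\<Sum>\<^sub>\<infinity>i. l1_norm (L i))"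
    using l1_comparison(2)[OF cont le B] infsum_swap_banach[OF joint'] by (simp add: l1_norm_def)
  assume t: "cmod t = 1"
  have "(\<lambda>p. norm (case p of (k, i) \<Rightarrow> L i k x * t powi k)) summable_on UNIV \<times> UNIV"
    by (rule Infinite_Sum.abs_summable_on_comparison_test'[OF joint'])
      (use t l1_coeff_le[OF L] in \<open>auto simp: norm_mult norm_power_int\<close>)
  then have "(\<lambda>(k, i). L i k x * t powi k) summable_on UNIV \<times> UNIV"
    by (rule abs_summable_summable)
  from infsum_swap_banach[OF this]
  show "gelfand (\<lambda>k x. \<Sum>\<^sub>\<infinity>i. L i k x) x t = (\<Sum>\<^sub>\<infinity>i. gelfand (L i) x t)"
    by (simp add: gelfand_def infsum_cmult_left')
qed

text \<open>The product is the sum over \<open>k\<close> of the elements \<open>?L k\<close>, in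
  which \<open>l'\<close> is shifted by \<open>k\<close> and multiplied by the single coefficient
  \<open>l k\<close>. All three claims follow from the results on infinite sums.\<close>

lemma
  fixes l :: "int \<Rightarrow> 'a \<Rightarrow> complex"
  assumes l: "l \<in> l1" and l': "l' \<in> l1"
  shows l1_conv_closed: "l1_conv l l' \<in> l1"
    and l1_norm_conv_le: "l1_norm (l1_conv l l') \<le> l1_norm l * l1_norm l'"
    and gelfand_conv: "cmod t = 1 \<Longrightarrow> gelfand (l1_conv l l') x t = gelfand l x t * gelfand l' x t"
proof -
  let ?L = "\<lambda>k n x. l k x * l' (n - k) x"
  have shift: "bij_betw (\<lambda>n::int. n - k) UNIV UNIV" for k
    by (rule bij_betwI[where g = "\<lambda>n. n + k"]) auto
  have cx: "?L k n \<in> cx" for k n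
    using l l' continuous_on_mult[of UNIV "l k" "l' (n - k)"] by (simp add: l1_def cx_def)
  have le: "cmod (?L k n x) \<le> supnorm (l k) * supnorm (l' (n - k))" for k n x
    unfolding norm_mult by (intro mult_mono l1_coeff_le l l' l1_supnorm_nonneg) simp
  have s: "(\<lambda>n. supnorm (l k) * supnorm (l' (n - k))) summable_on UNIV" for k
    using l' summable_on_reindex_bij_betw[OF shift, of "\<lambda>n. supnorm (l' n)"]
    by (intro summable_on_cmult_right) (simp add: l1_def)
  have L: "?L k \<in> l1" for k
    by (rule l1_comparison(1)[OF cx le s])
  have norm_L: "l1_norm (?L k) \<le> supnorm (l k) * l1_norm l'" for k
    using l1_comparison(2)[OF cx le s] infsum_reindex_bij_betw[OF shift, of "\<lambda>n. supnorm (l' n)"]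
    by (simp add: infsum_cmult_right' l1_norm_def)
  have bound: "(\<lambda>k. supnorm (l k) * l1_norm l') summable_on UNIV"
    using l by (intro summable_on_cmult_left) (simp add: l1_def)
  have sum: "(\<lambda>k. l1_norm (?L k)) summable_on UNIV"
    by (rule summable_on_comparison_test[OF bound norm_L l1_norm_nonneg[OF L]])
  show "l1_conv l l' \<in> l1"
    unfolding l1_conv_def by (rule infsum_in_l1[OF L sum])
  have "l1_norm (l1_conv l l') \<le> (\<Sum>\<^sub>\<infinity>k. supnorm (l k) * l1_norm l')"
    using l1_norm_infsum_le[OF L sum] infsum_mono[OF sum bound norm_L] by (simp add: l1_conv_def)
  then show "l1_norm (l1_conv l l') \<le> l1_norm l * l1_norm l'"
    by (simp add: infsum_cmult_left' l1_norm_def)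
  assume t: "cmod t = 1"
  then have "t \<noteq> 0" by auto
  have "gelfand (?L k) x t = l k x * t powi k * gelfand l' x t" for k
  proof -
    \<comment> \<open>Splitting \<open>t powi n\<close> as \<open>t powi k * t powi (n - k)\<close>
      lets the shift by \<open>k\<close> be undone by reindexing.\<close>
    have "gelfand (?L k) x t = (\<Sum>\<^sub>\<infinity>n. l k x * t powi k * (l' (n - k) x * t powi (n - k)))"
      unfolding gelfand_def using \<open>t \<noteq> 0\<close> by (intro infsum_cong) (simp add: power_int_diff)
    also have "\<dots> = l k x * t powi k * gelfand l' x t"
      unfolding gelfand_def infsum_cmult_right'
      by (simp add: infsum_reindex_bij_betw[OF shift, of "\<lambda>n. l' n x * t powi n"])
    finally show ?thesis .
  qed
  then show "gelfand (l1_conv l l') x t = gelfand l x t * gelfand l' x t"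
    unfolding l1_conv_def gelfand_infsum[OF L sum t]
    by (simp only: infsum_cmult_left' gelfand_def[of l, symmetric])
qed

lemma l1_power_closed:
  fixes l :: "int \<Rightarrow> 'a \<Rightarrow> complex"
  assumes "l \<in> l1"
  shows "l1_power l n \<in> l1"
  by (induction n) (simp_all add: one_in_l1 l1_conv_closed assms)

lemma gelfand_power:
  fixes l :: "int \<Rightarrow> 'a \<Rightarrow> complex"
  assumes "l \<in> l1" "cmod t = 1"
  shows "gelfand (l1_power l n) x t = gelfand l x t ^ n"
  by (induction n) (simp_all add: gelfand_one gelfand_conv l1_power_closed assms)

section \<open>Spectral radius estimate and Neumann series\<close>

lemma l1_norm_power_finite_support_le:
  fixes p :: "int \<Rightarrow> 'a \<Rightarrow> complex"
  assumes p: "p \<in> l1" "\<forall>k x. \<bar>k\<bar> > int K \<longrightarrow> p k x = 0"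
    and R: "\<forall>x t. cmod t = 1 \<longrightarrow> cmod (gelfand p x t) \<le> R"
  shows "l1_norm (l1_power p m) \<le> (2 * real (m * K) + 1) * R ^ m"
proof -
  let ?I = "{- int (m * K)..int (m * K)}" and ?q = "l1_power p m"
  let ?B = "\<lambda>k. if k \<in> ?I then R ^ m else 0"
  have q: "?q \<in> l1"
    by (rule l1_power_closed[OF p(1)])
  have cx: "?q k \<in> cx" for k
    using q by (simp add: l1_def)
  have le: "cmod (?q k x) \<le> ?B k" for k x
  proof (cases "k \<in> ?I")
    case True
    have "cmod (?q k x) \<le> R ^ m"
      by (rule l1_coeff_le_gelfand[OF q])
        (use R in \<open>simp add: gelfand_power p(1) norm_power power_mono\<close>)
    then show ?thesis
      using True by simp
  next
    case False
    then have "\<bar>k\<bar> > int (m * K)"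
      by auto
    then show ?thesis
      using l1_power_finite_support[OF p(2)] False by auto
  qed
  have B: "?B summable_on UNIV"
    by (rule finite_nonzero_values_imp_summable_on) (auto intro: finite_subset[of _ ?I])
  have "l1_norm ?q \<le> infsum ?B UNIV"
    by (rule l1_comparison(2)[OF cx le B])
  also have "\<dots> = infsum ?B ?I"
    by (rule infsum_cong_neutral) auto
  \<comment> \<open>The interval \<open>?I\<close> has \<open>2 * m * K + 1\<close>
    elements.\<close>
  also have "\<dots> = (2 * real (m * K) + 1) * R ^ m"
    by (simp add: nat_add_distrib)
  finally show ?thesis .
qed

text \<open>The mixed powers replace the binomial expansion of \<open>(p + e)\<^sup>n\<close>.\<close>

lemma l1_norm_power_mixed_le:
  fixes p :: "int \<Rightarrow> 'a \<Rightarrow> complex"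
  assumes p: "p \<in> l1" "\<forall>k x. \<bar>k\<bar> > int K \<longrightarrow> p k x = 0"
    and e: "e \<in> l1" "l1_norm e \<le> \<epsilon>"
    and R: "\<forall>x t. cmod t = 1 \<longrightarrow> cmod (gelfand p x t) \<le> R"
    and g: "g = l1_add p e"
  shows "l1_norm (l1_conv (l1_power g n) (l1_power p m))
    \<le> (2 * real ((n + m) * K) + 1) * (R + \<epsilon>) ^ n * R ^ m"
proof (induction n arbitrary: m)
  case 0
  have "l1_conv (l1_power g 0) (l1_power p m) = l1_power p m"
    by (rule l1_eqI_gelfand) (simp_all add: l1_conv_closed one_in_l1 l1_power_closed p gelfand_conv gelfand_one)
  then show ?case
    using l1_norm_power_finite_support_le[OF p R, of m] by simp
next
  case (Suc n)
  have "0 \<le> R"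
    using R norm_ge_zero order_trans by (metis norm_one)
  have "0 \<le> \<epsilon>"
    using l1_norm_nonneg[OF e(1)] e(2) by linarith
  have gl1: "g \<in> l1"
    unfolding g by (rule l1_add_closed(1)[OF p(1) e(1)])
  note closed = l1_conv_closed l1_power_closed l1_add_closed(1) p(1) e(1) gl1
  let ?u = "l1_conv (l1_power g n) (l1_power p m)"
  let ?v = "l1_conv (l1_power g n) (l1_power p (Suc m))"
  have "gelfand g x t = gelfand p x t + gelfand e x t" if "cmod t = 1" for x t
    unfolding g by (rule gelfand_add[OF p(1) e(1) that])
  \<comment> \<open>One factor \<open>g = p + e\<close> is split off. Its part \<open>e\<close> is
    paid for in norm, while its part \<open>p\<close> is absorbed into the power of
    \<open>p\<close>, which is why the induction needs arbitrary \<open>m\<close>.\<close>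
  then have "l1_conv (l1_power g (Suc n)) (l1_power p m) = l1_add (l1_conv e ?u) ?v"
    by (intro l1_eqI_gelfand closed)
      (simp add: gelfand_conv gelfand_add gelfand_power closed algebra_simps del: l1_power.simps)
  then have "l1_norm (l1_conv (l1_power g (Suc n)) (l1_power p m)) \<le> l1_norm (l1_conv e ?u) + l1_norm ?v"
    using l1_add_closed(2)[of "l1_conv e ?u" ?v] closed by (simp del: l1_power.simps)
  also have "l1_norm (l1_conv e ?u) \<le> l1_norm e * l1_norm ?u"
    by (intro l1_norm_conv_le closed)
  also have "\<dots> \<le> \<epsilon> * ((2 * real ((n + m) * K) + 1) * (R + \<epsilon>) ^ n * R ^ m)"
    by (intro mult_mono Suc.IH e l1_norm_nonneg closed \<open>0 \<le> \<epsilon>\<close>)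
  \<comment> \<open>The polynomial factor is raised to the one that bounds \<open>?v\<close>; the
    two bounds then combine through \<open>\<epsilon> + R\<close> into one more power of
    \<open>R + \<epsilon>\<close>.\<close>
  also have "\<dots> \<le> \<epsilon> * ((2 * real ((Suc n + m) * K) + 1) * (R + \<epsilon>) ^ n * R ^ m)"
    using \<open>0 \<le> \<epsilon>\<close> \<open>0 \<le> R\<close> by (intro mult_left_mono mult_right_mono) (auto simp: algebra_simps)
  also have "l1_norm ?v \<le> (2 * real ((n + Suc m) * K) + 1) * (R + \<epsilon>) ^ n * R ^ Suc m"
    by (rule Suc.IH)
  finally show ?case
    by (simp add: algebra_simps)
qed

text \<open>Cutting \<open>g\<close> off outside a large symmetric interval produces a main part to
  which the finite support estimates apply, at the cost of a small norm error.\<close>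

lemma l1_truncation:
  fixes g :: "int \<Rightarrow> 'a \<Rightarrow> complex"
  assumes g: "g \<in> l1" and "0 < \<epsilon>"
  obtains K p e where "p \<in> l1" "\<forall>k x. \<bar>k\<bar> > int K \<longrightarrow> p k x = 0" "e \<in> l1" "l1_norm e \<le> \<epsilon>"
    "g = l1_add p e"
proof -
  have s: "(\<lambda>k. supnorm (g k)) summable_on UNIV"
    using g by (simp add: l1_def)
  obtain F where F: "finite F" "\<And>F'. F \<subseteq> F' \<Longrightarrow> (\<Sum>\<^sub>\<infinity>k\<in>-F'. supnorm (g k)) \<le> \<epsilon>"
    using summable_tail_le[OF s l1_supnorm_nonneg[OF g] \<open>0 < \<epsilon>\<close>] by blast
  \<comment> \<open>The sum of all absolute values in \<open>F\<close> is a crude common bound for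
    its members.\<close>
  obtain K where K: "\<And>k. k \<in> F \<Longrightarrow> \<bar>k\<bar> \<le> int K"
  proof
    fix k assume "k \<in> F"
    then have "nat \<bar>k\<bar> \<le> (\<Sum>k\<in>F. nat \<bar>k\<bar>)"
      using F(1) by (intro member_le_sum) auto
    then show "\<bar>k\<bar> \<le> int (\<Sum>k\<in>F. nat \<bar>k\<bar>)"
      by linarith
  qed
  let ?I = "{k. \<bar>k\<bar> \<le> int K}"
  let ?r = "\<lambda>A k x. if k \<in> A then g k x else 0"
  have cx: "?r A k \<in> cx" for A k
    using g by (cases "k \<in> A") (simp_all add: l1_def cx_def)
  have le: "cmod (?r A k x) \<le> (if k \<in> A then supnorm (g k) else 0)" for A k x
    using l1_coeff_le[OF g] by simp
  have B: "(\<lambda>k. if k \<in> A then supnorm (g k) else 0) summable_on UNIV" for A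
    by (rule summable_on_comparison_test[OF s]) (auto intro: l1_supnorm_nonneg[OF g])
  have "l1_norm (?r (- ?I)) \<le> (\<Sum>\<^sub>\<infinity>k. if k \<in> - ?I then supnorm (g k) else 0)"
    by (rule l1_comparison(2)[OF cx le B])
  also have "\<dots> = (\<Sum>\<^sub>\<infinity>k\<in>- ?I. supnorm (g k))"
    by (rule infsum_cong_neutral) auto
  also have "\<dots> \<le> \<epsilon>"
    by (rule F(2)) (use K in auto)
  finally show thesis
    by (intro that[of "?r ?I" K "?r (- ?I)"] l1_comparison(1)[OF cx le B])
      (auto simp: l1_add_def fun_eq_iff)
qed

text \<open>The spectral radius estimate in the form that the Neumann series requires: up to a
  factor linear in \<open>n\<close>, the norm of the \<open>n\<close>-th power is at most
  \<open>q ^ n\<close> with \<open>q < 1\<close>.\<close>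

lemma l1_norm_power_summable:
  fixes g :: "int \<Rightarrow> 'a \<Rightarrow> complex"
  assumes g: "g \<in> l1" and r: "r < 1" "\<forall>x t. cmod t = 1 \<longrightarrow> cmod (gelfand g x t) \<le> r"
  shows "(\<lambda>n. l1_norm (l1_power g n)) summable_on UNIV"
proof -
  \<comment> \<open>An \<epsilon> is lost twice, in passing from \<open>g\<close> to its truncation
    and in the mixed power estimate; a third of the gap keeps \<open>r + 2 * \<epsilon>\<close>
    below 1.\<close>
  define \<epsilon> where "\<epsilon> = (1 - r) / 3"
  have "0 < \<epsilon>"
    using r by (simp add: \<epsilon>_def)
  obtain K p e where p: "p \<in> l1" "\<forall>k x. \<bar>k\<bar> > int K \<longrightarrow> p k x = 0"
    and e: "e \<in> l1" "l1_norm e \<le> \<epsilon>" and pe: "g = l1_add p e"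
    using l1_truncation[OF g \<open>0 < \<epsilon>\<close>] by metis
  have R: "\<forall>x t. cmod t = 1 \<longrightarrow> cmod (gelfand p x t) \<le> r + \<epsilon>"
  proof (intro allI impI)
    fix x t assume that: "cmod (t :: complex) = 1"
    have "gelfand p x t = gelfand g x t - gelfand e x t"
      using gelfand_add[OF p(1) e(1) that] by (simp add: pe)
    moreover have "cmod (gelfand g x t) \<le> r" "cmod (gelfand e x t) \<le> \<epsilon>"
      using r(2) that gelfand_le_l1_norm[OF e(1) that, of x] e(2) by auto
    ultimately show "cmod (gelfand p x t) \<le> r + \<epsilon>"
      using norm_triangle_ineq4[of "gelfand g x t" "gelfand e x t"] by simp
  qed
  define q where "q = r + \<epsilon> + \<epsilon>"
  have "0 \<le> r"
    using r(2) norm_ge_zero order_trans by (metis norm_one)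
  then have q: "0 \<le> q" "q < 1"
    using r \<open>0 < \<epsilon>\<close> by (simp_all add: q_def \<epsilon>_def field_simps)
  have bound: "l1_norm (l1_power g n) \<le> (2 * real K + 1) * (of_nat (Suc n) * q ^ n)" for n
  proof -
    \<comment> \<open>The case \<open>m = 0\<close> of the mixed estimate bounds the powers of
      \<open>g\<close> themselves.\<close>
    have "l1_conv (l1_power g n) (l1_power p 0) = l1_power g n"
      by (rule l1_eqI_gelfand)
        (simp_all add: l1_conv_closed one_in_l1 l1_power_closed g gelfand_conv gelfand_one)
    then have "l1_norm (l1_power g n) \<le> (2 * real (n * K) + 1) * q ^ n"
      using l1_norm_power_mixed_le[OF p e R pe, of n 0] by (simp add: q_def)
    \<comment> \<open>This form makes the majorant a multiple of the differentiated geometric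
      series.\<close>
    also have "\<dots> \<le> ((2 * real K + 1) * of_nat (Suc n)) * q ^ n"
      using q by (intro mult_right_mono) (auto simp: algebra_simps)
    finally show ?thesis
      by (simp add: mult.assoc)
  qed
  have "summable (\<lambda>n. of_nat (Suc n) * q ^ n)"
    using geometric_deriv_sums[of q] q by (simp add: sums_iff)
  then have "summable (\<lambda>n. (2 * real K + 1) * (of_nat (Suc n) * q ^ n))"
    by (rule summable_mult)
  then have "summable (\<lambda>n. l1_norm (l1_power g n))"
    by (rule summable_comparison_test') (use bound l1_norm_nonneg[OF l1_power_closed[OF g]] in simp)
  then show ?thesis
    by (rule summable_nonneg_imp_summable_on) (rule l1_norm_nonneg[OF l1_power_closed[OF g]])
qed

text \<open>The inverse is the sum of the powers of \<open>g\<close>. Since \<open>S x\<close>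
  contains 0 and is closed under addition, every power is supported in \<open>S\<close>, and so is
  the sum.\<close>

lemma neumann_inverse:
  fixes g :: "int \<Rightarrow> 'a \<Rightarrow> complex"
  assumes S: "\<And>x. 0 \<in> S x" "\<And>x m n. m \<in> S x \<Longrightarrow> n \<in> S x \<Longrightarrow> m + n \<in> S x"
    and g: "g \<in> l1_supported S"
    and r: "r < 1" "\<forall>x t. cmod t = 1 \<longrightarrow> cmod (gelfand g x t) \<le> r"
  obtains b where "b \<in> l1_supported S"
    "\<And>x t. cmod t = 1 \<Longrightarrow> (1 - gelfand g x t) * gelfand b x t = 1"
proof
  have gl1: "g \<in> l1"
    using g by (simp add: l1_supported_def)
  let ?b = "\<lambda>k x. \<Sum>\<^sub>\<infinity>n. l1_power g n k x"
  note sum = l1_norm_power_summable[OF gl1 r]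
  have "l1_power g n k x = 0" if "k \<notin> S x" for n k x
    using that
  proof (induction n arbitrary: k)
    case 0
    then show ?case
      using S(1)[of x] by (auto simp: l1_one_def)
  next
    case (Suc n)
    have "g j x = 0 \<or> l1_power g n (k - j) x = 0" for j
      using S(2)[of j x "k - j"] Suc g by (auto simp: l1_supported_def)
    then show ?case
      by (simp add: l1_conv_eq_0)
  qed
  then show "?b \<in> l1_supported S"
    using infsum_in_l1[OF l1_power_closed[OF gl1] sum] by (simp add: l1_supported_def)
  fix x t assume t: "cmod (t :: complex) = 1"
  let ?z = "gelfand g x t"
  have z: "cmod ?z < 1"
    using r t by (meson order_le_less_trans)
  have "((\<lambda>n. ?z ^ n) has_sum (1 / (1 - ?z))) UNIV"
    using z by (intro norm_summable_imp_has_sum geometric_sums) (simp_all add: norm_power summable_geometric)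
  then have "gelfand ?b x t = 1 / (1 - ?z)"
    unfolding gelfand_infsum[OF l1_power_closed[OF gl1] sum t]
    by (simp add: gelfand_power gl1 t infsumI)
  moreover have "1 - ?z \<noteq> 0"
    using z by auto
  ultimately show "(1 - ?z) * gelfand ?b x t = 1"
    by simp
qed

end

section \<open>Integer iterates, periods and the description of the commutant\<close>

lemma spow_0: "spow \<sigma> 0 x = x"
  by (simp add: spow_def)

lemma spow_plus_1:
  assumes "bij \<sigma>"
  shows "spow \<sigma> (k + 1) x = \<sigma> (spow \<sigma> k x)"
proof (cases "k \<ge> 0")
  case True
  then show ?thesis
    by (simp add: spow_def nat_add_distrib)
next
  case False
  then have "nat (- k) = Suc (nat (- (k + 1)))"
    by linarith
  then have "\<sigma> (spow \<sigma> k x) = (inv \<sigma> ^^ nat (- (k + 1))) x"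
    using False assms by (simp add: spow_def bij_is_surj surj_f_inv_f)
  also have "\<dots> = spow \<sigma> (k + 1) x"
    using False by (simp add: spow_def)
  finally show ?thesis ..
qed

lemma spow_add:
  assumes "bij \<sigma>"
  shows "spow \<sigma> (m + n) x = spow \<sigma> m (spow \<sigma> n x)"
proof (induction m rule: int_induct[where k = 0])
  case base
  then show ?case
    by (simp add: spow_0)
next
  case (step1 m)
  then show ?case
    using spow_plus_1[OF assms, of "m + n" x] spow_plus_1[OF assms, of m "spow \<sigma> n x"]
    by (simp add: add.commute add.left_commute)
next
  case (step2 m)
  \<comment> \<open>In the downward step both sides are compared after applying the injective map
    \<open>\<sigma>\<close>.\<close>
  have "\<sigma> (spow \<sigma> (m - 1 + n) x) = \<sigma> (spow \<sigma> (m - 1) (spow \<sigma> n x))"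
    using step2 spow_plus_1[OF assms, of "m - 1 + n" x] spow_plus_1[OF assms, of "m - 1" "spow \<sigma> n x"]
    by simp
  then show ?case
    using assms by (simp add: bij_is_inj inj_eq)
qed

text \<open>For bijective \<open>\<sigma>\<close> this is the stabilizer of \<open>x\<close> under
  the action of the integers. The sign matches the one in \<open>alpha\<close>.\<close>

definition periods :: "('a \<Rightarrow> 'a) \<Rightarrow> 'a \<Rightarrow> int set" where
  "periods \<sigma> x = {k. spow \<sigma> (- k) x = x}"

lemma zero_in_periods: "0 \<in> periods \<sigma> x"
  by (simp add: periods_def spow_0)

lemma periods_add:
  assumes "bij \<sigma>" "m \<in> periods \<sigma> x" "n \<in> periods \<sigma> x"
  shows "m + n \<in> periods \<sigma> x"
  using assms spow_add[OF assms(1), of "- m" "- n" x] by (simp add: periods_def)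

lemma periods_minus:
  assumes "bij \<sigma>" "n \<in> periods \<sigma> x"
  shows "- n \<in> periods \<sigma> x"
  using assms spow_add[OF assms(1), of n "- n" x] by (simp add: periods_def spow_0)

text \<open>A compact Hausdorff space is normal, and Urysohn's lemma applies to the two closed
  singletons.\<close>

lemma compact_t2_separate_points:
  fixes x y :: "'a::t2_space"
  assumes "compact (UNIV :: 'a set)" "x \<noteq> y"
  obtains f :: "'a \<Rightarrow> complex" where "f \<in> cx" "f x \<noteq> f y"
proof -
  have "Hausdorff_space (euclidean :: 'a topology)"
    unfolding Hausdorff_space_def disjnt_def using hausdorff by fastforce
  moreover have "compact_space (euclidean :: 'a topology)"
    using assms(1) by (simp add: compact_space_def)
  ultimately have "normal_space (euclidean :: 'a topology)"
    by (simp add: compact_Hausdorff_or_regular_imp_normal_space)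
  then obtain g :: "'a \<Rightarrow> real" where "continuous_map euclidean euclideanreal g" "g ` {x} \<subseteq> {0}" "g ` {y} \<subseteq> {1}"
    by (rule Urysohn_lemma_alt[where S = "{x}" and T = "{y}"]) (use assms(2) in auto)
  then show thesis
    by (intro that[of "\<lambda>x. of_real (g x)"]) (auto simp: cx_def intro: continuous_on_of_real)
qed

lemma l1_mult_embed_left: "l1_mult \<sigma> (embed f) l n x = f x * l n x"
proof -
  have "l1_mult \<sigma> (embed f) l n x = (\<Sum>\<^sub>\<infinity>k\<in>{0}. embed f k x * alpha \<sigma> k (l (n - k)) x)"
    unfolding l1_mult_def by (rule infsum_cong_neutral) (auto simp: embed_def)
  then show ?thesis
    by (simp add: embed_def alpha_def spow_0)
qed

lemma l1_mult_embed_right: "l1_mult \<sigma> l (embed f) n x = l n x * f (spow \<sigma> (- n) x)"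
proof -
  have "l1_mult \<sigma> l (embed f) n x = (\<Sum>\<^sub>\<infinity>k\<in>{n}. l k x * alpha \<sigma> k (embed f (n - k)) x)"
    unfolding l1_mult_def by (rule infsum_cong_neutral) (auto simp: embed_def alpha_def)
  then show ?thesis
    by (simp add: embed_def alpha_def)
qed

text \<open>Comparing coefficients, commuting with \<open>f\<close> means that
  \<open>f x - f (spow \<sigma> (- k) x)\<close> annihilates \<open>l k x\<close>; if
  \<open>k\<close> is not a period of \<open>x\<close>, some \<open>f\<close> makes this difference
  nonzero.\<close>

lemma commutant_eq_supported:
  fixes \<sigma> :: "'a::t2_space \<Rightarrow> 'a"
  assumes "compact (UNIV :: 'a set)"
  shows "commutant \<sigma> = l1_supported (periods \<sigma>)"
proof (intro equalityI subsetI)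
  fix l assume l: "l \<in> commutant \<sigma>"
  have "l k x = 0" if "k \<notin> periods \<sigma> x" for k x
  proof -
    from that have "x \<noteq> spow \<sigma> (- k) x"
      by (auto simp: periods_def)
    then obtain f :: "'a \<Rightarrow> complex" where f: "f \<in> cx" "f x \<noteq> f (spow \<sigma> (- k) x)"
      using compact_t2_separate_points[OF assms] by metis
    then have "l1_mult \<sigma> (embed f) l k x = l1_mult \<sigma> l (embed f) k x"
      using l by (auto simp: commutant_def)
    then show ?thesis
      using f(2) by (simp add: l1_mult_embed_left l1_mult_embed_right)
  qed
  then show "l \<in> l1_supported (periods \<sigma>)"
    using l by (simp add: l1_supported_def commutant_def)
next
  fix l assume l: "l \<in> l1_supported (periods \<sigma>)"
  have "f x * l k x = l k x * f (spow \<sigma> (- k) x)" for f :: "'a \<Rightarrow> complex" and k x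
    using l by (cases "k \<in> periods \<sigma> x") (auto simp: l1_supported_def periods_def)
  then show "l \<in> commutant \<sigma>"
    using l by (simp add: l1_supported_def commutant_def fun_eq_iff l1_mult_embed_left l1_mult_embed_right)
qed

text \<open>Wherever \<open>l k x\<close> is nonzero, \<open>k\<close> is a period of
  \<open>x\<close>, so \<open>alpha \<sigma> k\<close> does not change values at
  \<open>x\<close>.\<close>

lemma l1_mult_eq_conv:
  assumes "l \<in> l1_supported (periods \<sigma>)"
  shows "l1_mult \<sigma> l l' = l1_conv l l'"
proof -
  have "l k x * alpha \<sigma> k (l' (n - k)) x = l k x * l' (n - k) x" for n k x
    using assms by (cases "k \<in> periods \<sigma> x") (auto simp: l1_supported_def periods_def alpha_def)
  then show ?thesis
    unfolding l1_mult_def l1_conv_def by (intro ext infsum_cong)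
qed

text \<open>At each point self-adjointness becomes \<open>cnj (l n x) = l (- n) x\<close>, and
  conjugation inverts \<open>t\<close>. Conjugating the series thus only exchanges the indices
  \<open>n\<close> and \<open>- n\<close>.\<close>

lemma self_adjoint_gelfand_real:
  assumes "bij \<sigma>" and l: "l \<in> l1_supported (periods \<sigma>)" "l1_star \<sigma> l = l" and t: "cmod t = 1"
  shows "gelfand l x t \<in> \<real>"
proof -
  have coeff: "cnj (l n x) = l (- n) x" for n
  proof (cases "n \<in> periods \<sigma> x")
    case True
    then have "spow \<sigma> n x = x"
      using periods_minus[OF assms(1) True] by (simp add: periods_def)
    then have "l1_star \<sigma> l (- n) x = cnj (l n x)"
      by (simp add: l1_star_def alpha_def)
    then show ?thesis
      using l(2) by simp
  next
    case False
    then have "- n \<notin> periods \<sigma> x"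
      using periods_minus[OF assms(1), of "- n"] by auto
    then show ?thesis
      using False l(1) by (simp add: l1_supported_def)
  qed
  have neg: "bij_betw uminus (UNIV :: int set) UNIV"
    by (rule bij_betwI[where g = uminus]) auto
  have "cnj t = inverse t"
    using t by (simp add: inverse_complex_def complex_eq_iff cmod_def)
  then have "cnj (t powi n) = t powi (- n)" for n
    by (simp add: power_int_def)
  then have "cnj (gelfand l x t) = (\<Sum>\<^sub>\<infinity>n. l (- n) x * t powi (- n))"
    by (simp add: gelfand_def infsum_cnj[symmetric] coeff del: infsum_cnj)
  also have "\<dots> = gelfand l x t"
    unfolding gelfand_def by (rule infsum_reindex_bij_betw[OF neg])
  finally show ?thesis
    by (simp add: Reals_cnj_iff)
qed

section \<open>The algebra of elements supported in the periods: hermitian and semisimple\<close>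

context
  fixes \<sigma> :: "'a::t2_space \<Rightarrow> 'a" and A
  assumes compact: "compact (UNIV :: 'a set)" and bij: "bij \<sigma>"
  defines "A \<equiv> l1_supported (periods \<sigma>)"
begin

lemma supported_in_l1: "l \<in> A \<Longrightarrow> l \<in> l1"
  by (simp add: A_def l1_supported_def)

lemma supported_one: "l1_one \<in> A"
  using zero_in_periods[of \<sigma>] one_in_l1 by (auto simp: A_def l1_supported_def l1_one_def)

lemma supported_zero: "l1_zero \<in> A"
  by (simp add: A_def l1_supported_def l1_def cx_def l1_zero_def supnorm_def)

lemma supported_add: "l \<in> A \<Longrightarrow> l' \<in> A \<Longrightarrow> l1_add l l' \<in> A"
  using l1_add_closed(1)[OF compact] by (simp add: A_def l1_supported_def l1_add_def)

lemma supported_scale: "l \<in> A \<Longrightarrow> l1_scale c l \<in> A"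
  using l1_scale_closed[OF compact] by (simp add: A_def l1_supported_def l1_scale_def)

lemma supported_conv:
  assumes "l \<in> A" "l' \<in> A"
  shows "l1_conv l l' \<in> A"
proof -
  have "l1_conv l l' n x = 0" if "n \<notin> periods \<sigma> x" for n x
  proof (rule l1_conv_eq_0)
    show "l k x = 0 \<or> l' (n - k) x = 0" for k
      using periods_add[OF bij, of k x "n - k"] that assms by (auto simp: A_def l1_supported_def)
  qed
  then show ?thesis
    using l1_conv_closed[OF compact] assms by (simp add: A_def l1_supported_def)
qed

lemma supported_mult: "l \<in> A \<Longrightarrow> l1_mult \<sigma> l l' = l1_conv l l'"
  by (simp add: A_def l1_mult_eq_conv)

lemmas gelfand_simps = gelfand_one gelfand_scale
  gelfand_add[OF compact supported_in_l1 supported_in_l1] gelfand_conv[OF compact supported_in_l1 supported_in_l1]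

lemmas supported_closed = supported_one supported_add supported_scale supported_conv

lemma supported_inverse_self_adjoint_shift:
  assumes a: "a \<in> A" "l1_star \<sigma> a = a" and z: "z \<notin> \<real>"
  obtains b where "b \<in> A"
    "l1_conv (l1_add a (l1_scale (- z) l1_one)) b = l1_one"
    "l1_conv b (l1_add a (l1_scale (- z) l1_one)) = l1_one"
proof -
  let ?d = "\<lambda>w. l1_add a (l1_scale (- w) l1_one)"
  have d: "?d w \<in> A" for w
    by (intro supported_closed a)
  have gelfand_d: "gelfand (?d w) x t = gelfand a x t - w" if "cmod t = 1" for w x t
    using that by (simp add: gelfand_simps supported_closed a)
  define h where "h = l1_conv (?d z) (?d (cnj z))"
  have h: "h \<in> A"
    unfolding h_def by (intro supported_conv d)
  \<comment> \<open>By the triangle inequality the square of \<open>l1_norm a + cmod z\<close>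
    dominates every character value of \<open>h\<close>.\<close>
  define M where "M = (l1_norm a + cmod z)\<^sup>2"
  have gelfand_h: "\<exists>y. gelfand h x t = of_real y \<and> (Im z)\<^sup>2 \<le> y \<and> y \<le> M" if t: "cmod t = 1" for x t
  proof -
    let ?w = "gelfand a x t - z"
    have re: "gelfand a x t \<in> \<real>"
      using self_adjoint_gelfand_real[OF bij _ a(2) t] a(1) by (simp add: A_def)
    \<comment> \<open>As the character is real on \<open>a\<close>, the two factors of
      \<open>h\<close> have conjugate values.\<close>
    then have "gelfand h x t = ?w * cnj ?w"
      using t d by (simp add: h_def gelfand_simps(4) gelfand_d Reals_cnj_iff)
    also have "\<dots> = of_real ((cmod ?w)\<^sup>2)"
      by (rule complex_norm_square[symmetric])
    finally have eq: "gelfand h x t = of_real ((cmod ?w)\<^sup>2)" .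
    have "Im ?w = - Im z"
      using re by (simp add: complex_is_Real_iff)
    then have "(Im z)\<^sup>2 \<le> (cmod ?w)\<^sup>2"
      using abs_Im_le_cmod[of ?w] by (metis abs_le_square_iff abs_minus_cancel abs_norm_cancel)
    moreover have "cmod ?w \<le> l1_norm a + cmod z"
      using norm_triangle_ineq4[of "gelfand a x t" z] gelfand_le_l1_norm[OF compact supported_in_l1[OF a(1)] t, of x]
      by linarith
    then have "(cmod ?w)\<^sup>2 \<le> M"
      unfolding M_def by (intro power_mono) auto
    ultimately show ?thesis
      using eq by blast
  qed
  have im: "0 < (Im z)\<^sup>2"
    using z by (simp add: complex_is_Real_iff)
  \<comment> \<open>Evaluating at \<open>t = 1\<close> compares \<open>M\<close> with the positive
    number \<open>(Im z)\<^sup>2\<close>, so division by \<open>M\<close> is legitimate.\<close>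
  moreover obtain y where "(Im z)\<^sup>2 \<le> y" "y \<le> M"
    using gelfand_h[OF norm_one] by blast
  ultimately have M: "0 < M"
    by linarith
  \<comment> \<open>Thus \<open>g = 1 - h / M\<close>, whose character values lie between 0 and
    \<open>1 - (Im z)\<^sup>2 / M\<close>, uniformly below 1.\<close>
  define g where "g = l1_add l1_one (l1_scale (of_real (- 1 / M)) h)"
  have gA: "g \<in> A"
    unfolding g_def by (intro supported_closed h)
  have gelfand_g: "gelfand g x t = 1 - gelfand h x t / of_real M" if "cmod t = 1" for x t
    using that h by (simp add: g_def gelfand_simps supported_closed)
  have bound: "cmod (gelfand g x t) \<le> 1 - (Im z)\<^sup>2 / M" if t: "cmod t = 1" for x t
  proof -
    obtain y where y: "gelfand h x t = of_real y" "(Im z)\<^sup>2 \<le> y" "y \<le> M"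
      using gelfand_h[OF t] by blast
    have "gelfand g x t = of_real (1 - y / M)"
      using gelfand_g[OF t] y(1) by simp
    moreover have "0 \<le> 1 - y / M" "1 - y / M \<le> 1 - (Im z)\<^sup>2 / M"
      using y M by (simp_all add: divide_right_mono)
    ultimately show ?thesis
      by (simp only: norm_of_real)
  qed
  obtain c where c: "c \<in> A" "\<And>x t. cmod t = 1 \<Longrightarrow> (1 - gelfand g x t) * gelfand c x t = 1"
    using neumann_inverse[OF compact zero_in_periods periods_add[OF bij] gA[unfolded A_def],
        of "1 - (Im z)\<^sup>2 / M"] bound im M by (auto simp: A_def)
  \<comment> \<open>Since \<open>c\<close> inverts \<open>h / M\<close>, and \<open>h\<close> has
    the factor \<open>?d z\<close>, the remaining factor \<open>?d (cnj z) / M\<close> times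
    \<open>c\<close> inverts \<open>?d z\<close>.\<close>
  define b where "b = l1_conv (l1_scale (of_real (1 / M)) (?d (cnj z))) c"
  have b: "b \<in> A"
    unfolding b_def by (intro supported_conv supported_scale d c)
  have inv: "gelfand (?d z) x t * gelfand b x t = 1" if t: "cmod t = 1" for x t
  proof -
    have "gelfand (?d z) x t * gelfand b x t = gelfand h x t / of_real M * gelfand c x t"
      using t d c(1) by (simp add: b_def h_def gelfand_simps(2,4) supported_scale)
    also have "\<dots> = (1 - gelfand g x t) * gelfand c x t"
      by (simp add: gelfand_g[OF t])
    finally show ?thesis
      using c(2)[OF t] by simp
  qed
  show thesis
  proof (rule that[OF b])
    show "l1_conv (?d z) b = l1_one"
      using inv d b by (intro l1_eqI_gelfand[OF compact] supported_in_l1 supported_one supported_conv) (auto simp: gelfand_simps(1,4))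
    show "l1_conv b (?d z) = l1_one"
      using inv d b by (intro l1_eqI_gelfand[OF compact] supported_in_l1 supported_one supported_conv) (auto simp: gelfand_simps(1,4) mult.commute)
  qed
qed

lemma hermitian_supported: "hermitian \<sigma> A"
  unfolding hermitian_def alg_spectrum_def
proof (intro ballI impI subsetI, rule ccontr)
  fix a z
  assume a: "a \<in> A" "l1_star \<sigma> a = a" and z: "z \<notin> \<real>"
    and spec: "z \<in> {z. \<not> (\<exists>b\<in>A. l1_mult \<sigma> (l1_add a (l1_scale (- z) l1_one)) b = l1_one \<and>
      l1_mult \<sigma> b (l1_add a (l1_scale (- z) l1_one)) = l1_one)}"
  obtain b where "b \<in> A"
    "l1_conv (l1_add a (l1_scale (- z) l1_one)) b = l1_one"
    "l1_conv b (l1_add a (l1_scale (- z) l1_one)) = l1_one"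
    by (rule supported_inverse_self_adjoint_shift[OF a z])
  moreover have "l1_add a (l1_scale (- z) l1_one) \<in> A"
    by (intro supported_closed a)
  ultimately show False
    using spec supported_mult by auto
qed

text \<open>The kernel has codimension 1: an element outside it, suitably rescaled, differs from the
  unit by an element of the kernel. A larger left ideal would therefore contain the unit.\<close>

lemma gelfand_kernel_maximal:
  assumes t: "cmod t = 1"
  shows "maximal_left_ideal \<sigma> A {l \<in> A. gelfand l x t = 0}"
proof -
  let ?L = "{l \<in> A. gelfand l x t = 0}"
  have "l1_one \<notin> ?L"
    by (simp add: gelfand_one)
  then have "?L \<noteq> A"
    using supported_one by blast
  then have "left_ideal \<sigma> A ?L"
    using t supported_closed supported_zero by (auto simp: left_ideal_def supported_mult gelfand_simps gelfand_zero)
  moreover have "M = ?L" if M: "left_ideal \<sigma> A M" "?L \<subseteq> M" for M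
  proof (rule ccontr)
    assume "M \<noteq> ?L"
    then obtain m where m: "m \<in> M" "gelfand m x t \<noteq> 0" "m \<in> A"
      using M by (auto simp: left_ideal_def)
    let ?c = "1 / gelfand m x t"
    let ?u = "l1_add l1_one (l1_scale (- ?c) m)"
    have "?u \<in> ?L"
      using m t by (simp add: gelfand_simps supported_closed)
    then have "l1_add ?u (l1_scale ?c m) \<in> M"
      using M m by (auto simp: left_ideal_def)
    moreover have "l1_add ?u (l1_scale ?c m) = l1_one"
      by (simp add: l1_add_def l1_scale_def)
    ultimately have one: "l1_one \<in> M"
      by simp
    have "b \<in> M" if b: "b \<in> A" for b
    proof -
      have "l1_mult \<sigma> b l1_one = b"
        unfolding supported_mult[OF b] using b
        by (intro l1_eqI_gelfand[OF compact] supported_in_l1 supported_closed) (auto simp: gelfand_simps(1,4) supported_closed)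
      moreover have "l1_mult \<sigma> b l1_one \<in> M"
        using M(1) b one by (simp add: left_ideal_def)
      ultimately show ?thesis
        by simp
    qed
    then show False
      using M(1) by (auto simp: left_ideal_def)
  qed
  ultimately show ?thesis
    by (auto simp: maximal_left_ideal_def)
qed

text \<open>An element of the radical lies in the kernel of every character, and these kernels
  already have zero intersection by \<open>l1_eqI_gelfand\<close>.\<close>

lemma semisimple_supported: "semisimple \<sigma> A"
proof -
  have "l = l1_zero" if l: "l \<in> jacobson_radical \<sigma> A" for l
  proof (rule l1_eqI_gelfand[OF compact])
    have lA: "l \<in> A"
      using l by (simp add: jacobson_radical_def)
    then show "l \<in> l1" "(l1_zero :: int \<Rightarrow> 'a \<Rightarrow> complex) \<in> l1"
      using supported_zero by (simp_all add: supported_in_l1)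
    show "gelfand l x t = gelfand l1_zero x t" if "cmod t = 1" for x t
      using l gelfand_kernel_maximal[OF that, of x]
      by (auto simp: jacobson_radical_def gelfand_zero)
  qed
  moreover have "l1_zero \<in> jacobson_radical \<sigma> A"
    using supported_zero by (auto simp: jacobson_radical_def maximal_left_ideal_def left_ideal_def)
  ultimately show ?thesis
    by (auto simp: semisimple_def)
qed

end

theorem theorem3p9:
  fixes \<sigma> :: "'a::t2_space \<Rightarrow> 'a"
  assumes "compact (UNIV :: 'a set)"
    and "\<exists>\<tau>. homeomorphism UNIV UNIV \<sigma> \<tau>"
  shows "hermitian \<sigma> (commutant \<sigma>) \<and> semisimple \<sigma> (commutant \<sigma>)"
proof -
  have "bij \<sigma>"
    using assms(2) by (auto simp: homeomorphism_def intro: bij_betw_byWitness)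
  then show ?thesis
    using hermitian_supported[OF assms(1)] semisimple_supported[OF assms(1)]
    by (simp add: commutant_eq_supported[OF assms(1)])
qed

end
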